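(* Fix $n$, $\lambda>0$, $\eta\in(0,1)$. Let $F:H\to\mathbb R$ satisfy $|F(u)-F(v)|\le\psi(\|u-v\|)$ for all $u,v\in H$, where $\psi$ is a (nondecreasing) modulus of continuity. Suppose there are $(Q,R,B)$ such that: (i) there exists a Gaussian random element $Z$ in $H$ with covariance $\Sigma$ such that with probability at least $1-\eta$, $\|\sqrt n(\hat f-f_\lambda)-Z\|\le Q=Q(n,\lambda,\eta)$; (ii) there exists a random element $Z'$ in $H$ whose conditional distribution given $D$ is almost surely Gaussian with covariance $\Sigma$, and with probability at least $1-\eta$, $\mathbb P\{\|\mathfrak B-Z'\|\le R\mid D\}\ge1-\eta$, $R=R(n,\lambda,\eta)$; (iii) for every $\eta'\in(0,1)$, with probability at least $1-\eta'$, $\|Z\|\ge L(\lambda,\eta')$ for some function $L$ strictly increasing in its second argument; (iv) $\sqrt n\|f_\lambda-f_0\|\le B=B(\lambda)$. Let $\Delta=Q+R$. Suppose further (anti-concentration) that there is a nondecreasing function $\mathfrak a:(0,\infty)\to[0,1]$, potentially depending on $n$ and $\lambda$, with $\mathfrak a(r)\downarrow0$ as $r\downarrow0$ and $\sup_{t\in\mathbb R}\mathbb P\{|F(Z)-t|\le r\}\le\mathfrak a(r)$ for every $r>0$. Then with probability at least $1-\eta$ (over the data $D$), $$\sup_{t\in\mathbb R}\left|\mathbb P\left[F\{\sqrt n(\hat f-f_0)\}\le t\right]-\mathbb P\left\{F(\mathfrak B)\le t\mid D\right\}\right|\le\mathfrak a\{\psi(Q+B)\}+\mathfrak a\{\psi(R)\}+2\eta.$$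 Moreover, even without the anti-concentration assumption, with probability at least $1-\eta$, $$\sup_{t\in\mathbb R}\left|\mathbb P\left[F\{\sqrt n(\hat f-f_0)\}\le t\right]-\mathbb P\left\{F(\mathfrak B)\le t\mid D\right\}\right|\le2\sup_{t\in\mathbb R}\mathbb P\left\{|F(\mathfrak B)-t|\le2\psi(\Delta+B)\mid D\right\}+4\eta.$$
   Context: Setting. $S$ is a Polish space and $k:S\times S\to\mathbb R$ is a positive definite kernel with $k(x,x')\le\kappa^2$. $H$ is the (separable) reproducing kernel Hilbert space of $k$, with norm $\|\cdot\|$; $k_x=k(x,\cdot)$, $f(x)=\langle f,k_x\rangle$. The data $D=\{(X_i,Y_i)\}_{i=1}^n$ are i.i.d. in $S\times\mathbb R$; $f_0(x)=\mathbb E(Y\mid X=x)$, $f_0\in H$; $\varepsilon_i=Y_i-f_0(X_i)$ satisfies $|\varepsilon_i|\le\bar\sigma$ and $\mathbb E(\varepsilon_i^2\mid X_i)\ge\underline\sigma^2>0$. $\mathbb E_n(\cdot)=\frac1n\sum_{i=1}^n(\cdot)$; $u\otimes v^*:t\mapsto\langle v,t\rangle u$; $T=\mathbb E(k_X\otimes k_X^* )$, $\hat T=\mathbb E_n(k_X\otimes k_X^* )$. $\hat f=\arg\min_{f\in H}[\mathbb E_n\{Y-f(X)\}^2+\lambda\|f\|^2]$ and $f_\lambda=\arg\min_{f\in H}[\mathbb E\{Y-f(X)\}^2+\lambda\|f\|^2]$. $U_i=(T+\lambda)^{-1}\{(k_{X_i}\otimes k_{X_i}^*-T)(f_0-f_\lambda)+\varepsilon_ik_{X_i}\}$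 and $\Sigma=\mathbb E(U_i\otimes U_i^* )$. Bootstrap. $\hat\varepsilon_i=Y_i-\hat f(X_i)$, $\hat V_i=(\hat T+\lambda)^{-1}\hat\varepsilon_ik_{X_i}$, $\mathfrak B=\frac1n\sum_{i=1}^n\sum_{j=1}^n\frac{\hat V_i-\hat V_j}{\sqrt2}h_{ij}$ with $h_{ij}$ i.i.d. standard Gaussians independent of $D$. Gaussian elements are centered. *)

theory Defs
  imports "HOL-Probability.Probability"
begin

section \<open>Kernels and their reproducing kernel Hilbert space\<close>

definition pos_def_kernel :: "('s \<Rightarrow> 's \<Rightarrow> real) \<Rightarrow> bool" where
  "pos_def_kernel k \<longleftrightarrow> (\<forall>x y. k x y = k y x) \<and>
     (\<forall>A c. finite A \<longrightarrow> 0 \<le> (\<Sum>x\<in>A. \<Sum>y\<in>A. c x * c y * k x y))"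

text \<open>
  The Hilbert space of functions on the input space is represented by a type \<open>'h\<close>; its elements are
  identified with functions through \<open>rkhs_eval\<close>, which has to be injective. The map \<open>K\<close> sends \<open>x\<close> to
  the element of \<open>'h\<close> whose function is \<open>k x\<close>. The definition of \<open>rkhs_eval\<close> is the reproducing property.
\<close>

definition rkhs_eval :: "('s \<Rightarrow> 'h::real_inner) \<Rightarrow> 'h \<Rightarrow> 's \<Rightarrow> real" where
  "rkhs_eval K f x = inner f (K x)"

definition is_rkhs :: "('s \<Rightarrow> 's \<Rightarrow> real) \<Rightarrow> ('s \<Rightarrow> 'h::{real_inner,banach,polish_space}) \<Rightarrow> bool" where
  "is_rkhs k K \<longleftrightarrow> inj (rkhs_eval K) \<and> (\<forall>x. rkhs_eval K (K x) = k x)"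

definition tensor :: "'h::real_inner \<Rightarrow> 'h \<Rightarrow> 'h \<Rightarrow> 'h" where
  "tensor u v t = inner v t *\<^sub>R u"

text \<open>The operator \<open>(A + lam)\<inverse>\<close>; the map is bijective when \<open>A\<close> is bounded, positive, self-adjoint
  and \<open>lam > 0\<close>.\<close>

definition resolvent :: "('h::real_vector \<Rightarrow> 'h) \<Rightarrow> real \<Rightarrow> 'h \<Rightarrow> 'h" where
  "resolvent A lam = inv (\<lambda>t. A t + lam *\<^sub>R t)"


section \<open>Population quantities\<close>

text \<open>\<open>P\<close> is the law of one observation \<open>(X, Y)\<close>. Expectations of operators are taken pointwise, that
  is \<open>(E A) t = E (A t)\<close>, with the Bochner integral in the Hilbert space.\<close>

definition pop_ridge ::
    "('s \<Rightarrow> 'h::real_inner) \<Rightarrow> ('s \<times> real) measure \<Rightarrow> real \<Rightarrow> 'h" where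
  "pop_ridge K P lam =
     arg_min (\<lambda>f. (\<integral>z. (snd z - rkhs_eval K f (fst z))\<^sup>2 \<partial>P) + lam * (norm f)\<^sup>2) (\<lambda>f. True)"

definition pop_cov ::
    "('s \<Rightarrow> 'h::{real_inner,banach,polish_space}) \<Rightarrow> ('s \<times> real) measure \<Rightarrow> 'h \<Rightarrow> 'h" where
  "pop_cov K P t = (\<integral>z. tensor (K (fst z)) (K (fst z)) t \<partial>P)"

definition influence ::
    "('s \<Rightarrow> 'h::{real_inner,banach,polish_space}) \<Rightarrow> ('s \<times> real) measure \<Rightarrow> real \<Rightarrow> 'h
      \<Rightarrow> 's \<times> real \<Rightarrow> 'h" where
  "influence K P lam f0 z =
     (let b = f0 - pop_ridge K P lam in
      resolvent (pop_cov K P) lam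
        ((tensor (K (fst z)) (K (fst z)) b - pop_cov K P b)
          + (snd z - rkhs_eval K f0 (fst z)) *\<^sub>R K (fst z)))"

definition influence_cov ::
    "('s \<Rightarrow> 'h::{real_inner,banach,polish_space}) \<Rightarrow> ('s \<times> real) measure \<Rightarrow> real \<Rightarrow> 'h
      \<Rightarrow> 'h \<Rightarrow> 'h" where
  "influence_cov K P lam f0 t =
     (\<integral>z. tensor (influence K P lam f0 z) (influence K P lam f0 z) t \<partial>P)"


section \<open>Sample quantities\<close>

definition emp_mean :: "nat \<Rightarrow> (nat \<Rightarrow> 'b::real_vector) \<Rightarrow> 'b" where
  "emp_mean n g = (1 / real n) *\<^sub>R (\<Sum>i=1..n. g i)"

definition ridge :: "('s \<Rightarrow> 'h::real_inner) \<Rightarrow> nat \<Rightarrow> real \<Rightarrow> (nat \<Rightarrow> 's \<times> real) \<Rightarrow> 'h" where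
  "ridge K n lam d =
     arg_min (\<lambda>f. emp_mean n (\<lambda>i. (snd (d i) - rkhs_eval K f (fst (d i)))\<^sup>2) + lam * (norm f)\<^sup>2) (\<lambda>f. True)"

definition emp_cov :: "('s \<Rightarrow> 'h::real_inner) \<Rightarrow> nat \<Rightarrow> (nat \<Rightarrow> 's \<times> real) \<Rightarrow> 'h \<Rightarrow> 'h" where
  "emp_cov K n d t = emp_mean n (\<lambda>i. tensor (K (fst (d i))) (K (fst (d i))) t)"

definition emp_influence ::
    "('s \<Rightarrow> 'h::real_inner) \<Rightarrow> nat \<Rightarrow> real \<Rightarrow> (nat \<Rightarrow> 's \<times> real) \<Rightarrow> nat \<Rightarrow> 'h" where
  "emp_influence K n lam d i =
     resolvent (emp_cov K n d) lam
       ((snd (d i) - rkhs_eval K (ridge K n lam d) (fst (d i))) *\<^sub>R K (fst (d i)))"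

definition bootstrap ::
    "('s \<Rightarrow> 'h::real_inner) \<Rightarrow> nat \<Rightarrow> real \<Rightarrow> (nat \<Rightarrow> 's \<times> real) \<Rightarrow> (nat \<Rightarrow> nat \<Rightarrow> real) \<Rightarrow> 'h" where
  "bootstrap K n lam d g =
     (1 / real n) *\<^sub>R (\<Sum>i=1..n. \<Sum>j=1..n.
        g i j *\<^sub>R ((1 / sqrt 2) *\<^sub>R (emp_influence K n lam d i - emp_influence K n lam d j)))"


section \<open>Probabilistic notions\<close>

definition data :: "nat \<Rightarrow> (nat \<Rightarrow> 'w \<Rightarrow> 's) \<Rightarrow> (nat \<Rightarrow> 'w \<Rightarrow> real) \<Rightarrow> 'w \<Rightarrow> nat \<Rightarrow> 's \<times> real" where
  "data n X Y w = (\<lambda>i\<in>{1..n}. (X i w, Y i w))"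

definition data_algebra ::
    "'w measure \<Rightarrow> nat \<Rightarrow> (nat \<Rightarrow> 'w \<Rightarrow> 's::polish_space) \<Rightarrow> (nat \<Rightarrow> 'w \<Rightarrow> real) \<Rightarrow> 'w measure" where
  "data_algebra M n X Y = vimage_algebra (space M) (data n X Y) (\<Pi>\<^sub>M i\<in>{1..n}. borel)"

text \<open>``With probability at least \<open>p\<close>, \<open>Q\<close> holds'', the event being observable in the
  sub-sigma-algebra \<open>G\<close> of \<open>M\<close>. If \<open>{w \<in> space M. Q w}\<close> is in \<open>G\<close>, this just says that its measure is
  at least \<open>p\<close>.\<close>

definition with_prob :: "'w measure \<Rightarrow> 'w measure \<Rightarrow> real \<Rightarrow> ('w \<Rightarrow> bool) \<Rightarrow> bool" where
  "with_prob M G p Q \<longleftrightarrow> (\<exists>E\<in>sets G. p \<le> measure M E \<and> (\<forall>w\<in>E. Q w))"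

definition cond_probability :: "'w measure \<Rightarrow> 'w measure \<Rightarrow> 'w set \<Rightarrow> 'w \<Rightarrow> real" where
  "cond_probability M G A = real_cond_exp M G (indicator A)"

text \<open>\<open>\<kappa>\<close> is a regular conditional distribution of the random element \<open>X\<close> given \<open>G\<close>. In a
  Polish space one exists for every random element, and any two agree almost surely. A supremum over
  uncountably many conditional probabilities is read through such a version.\<close>

definition regular_cond_dist ::
    "'w measure \<Rightarrow> 'w measure \<Rightarrow> ('w \<Rightarrow> 'b::topological_space) \<Rightarrow> ('w \<Rightarrow> 'b measure) \<Rightarrow> bool" where
  "regular_cond_dist M G X \<kappa> \<longleftrightarrow>
     X \<in> borel_measurable M \<and> \<kappa> \<in> measurable G (prob_algebra borel) \<and>
     (\<forall>A\<in>sets borel. AE w in M. cond_probability M G (X -` A \<inter> space M) w = measure (\<kappa> w) A)"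

text \<open>The law of \<open>s N\<close> with \<open>N\<close> standard normal; \<open>s = 0\<close> gives the Dirac measure at \<open>0\<close>, which counts
  as Gaussian.\<close>

definition centered_normal :: "real \<Rightarrow> real measure" where
  "centered_normal s = distr (density lborel (\<lambda>x. ennreal (std_normal_density x))) borel (\<lambda>x. s * x)"

definition centered_gaussian :: "'h::real_inner measure \<Rightarrow> bool" where
  "centered_gaussian \<mu> \<longleftrightarrow> prob_space \<mu> \<and> sets \<mu> = sets borel \<and>
     (\<forall>u. \<exists>s\<ge>0. distr \<mu> borel (\<lambda>x. inner u x) = centered_normal s)"

text \<open>Only applied to centered Gaussian laws, for which the integrals are finite.\<close>

definition has_covariance :: "'h::real_inner measure \<Rightarrow> ('h \<Rightarrow> 'h) \<Rightarrow> bool" where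
  "has_covariance \<mu> C \<longleftrightarrow> (\<forall>u v. (\<integral>x. inner u x * inner v x \<partial>\<mu>) = inner u (C v))"

definition modulus_of_continuity :: "(real \<Rightarrow> real) \<Rightarrow> bool" where
  "modulus_of_continuity \<psi> \<longleftrightarrow> mono_on {0..} \<psi> \<and> \<psi> 0 = 0 \<and> (\<psi> \<longlongrightarrow> 0) (at_right 0)"

end

theory Submission
  imports Defs
begin

text \<open>
  Three distribution functions in \<open>t\<close> are compared: \<open>p t\<close> for \<open>F (sqrt n (f_hat - f0))\<close>, \<open>m t\<close> for
  \<open>F Z\<close>, and \<open>b t\<close> for \<open>F \<B>\<close> given the data. If two random elements are within distance \<open>d\<close> of each
  other outside an event of probability \<open>\<eta>\<close>, then their images under \<open>F\<close> are within \<open>\<psi> d\<close> there, so each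
  distribution function is bounded by the other one shifted by \<open>\<psi> d\<close>, up to \<open>\<eta>\<close>. With
  \<open>r1 = \<psi> (Q + B)\<close> this bounds \<open>p\<close> by shifts of \<open>m\<close>, since \<open>sqrt n (f_hat - f0)\<close> differs from
  \<open>sqrt n (f_hat - f_lam)\<close> by the bias, of norm at most \<open>B\<close>. With \<open>r2 = \<psi> R\<close> it bounds \<open>b\<close> by shifts of the
  conditional distribution function of \<open>F Z'\<close>. The latter is again \<open>m\<close>: a centered Gaussian law on a
  separable Hilbert space is determined by its covariance, so the conditional law of \<open>Z'\<close> is almost
  surely the law of \<open>Z\<close>.
  
  For the first bound the shifts are removed from \<open>m\<close>, where anti-concentration bounds an increment over a
  length \<open>r\<close> by \<open>\<aa> r\<close>. For the second bound they are chained, \<open>p t \<le> m (t + r1) + \<eta> \<le> b (t + r1 + r2) + 2 \<eta>\<close>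
  and likewise from below, and removed from \<open>b\<close>, at the price of the concentration function of
  \<open>F \<B>\<close> itself; \<open>r1 + r2 \<le> 2 \<psi> (Q + R + B)\<close> because \<open>\<psi>\<close> is nondecreasing.
  
  Three points need work. Uniqueness of the Gaussian law is
  \<open>centered_gaussian_eq_if_covariance_eq\<close>, which rests on a Cramer--Wold theorem for separable inner
  product spaces. The estimator \<open>f_hat\<close> is a selected minimiser, whose measurability
  (\<open>borel_measurable_ridge\<close>) is needed for \<open>p\<close> to be a distribution function at all. And the
  conditional comparison holds for each fixed \<open>t\<close> only almost surely, while the conclusion concerns all \<open>t\<close>
  at once on a single event of the data \<open>\<sigma>\<close>-algebra; \<open>conditional_cdf_sandwich\<close> obtains this from rational
  thresholds and right-continuity.
\<close>

section \<open>The Cramer--Wold theorem on a separable inner product space\<close>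

text \<open>
  Both measures have the same total mass, the characteristic function at \<open>0\<close>, so the case of probability
  measures applies after normalisation.
\<close>
lemma finite_measure_eq_if_char_eq:
  fixes N1 N2 :: "real measure"
  assumes "finite_measure N1" "finite_measure N2"
    and [measurable_cong]: "sets N1 = sets borel" "sets N2 = sets borel"
    and char: "\<And>t. char N1 t = char N2 t"
  shows "N1 = N2"
proof -
  interpret N1: finite_measure N1 by fact
  interpret N2: finite_measure N2 by fact
  define c where "c = measure N1 UNIV"
  have sp: "space N1 = UNIV" "space N2 = UNIV"
    using assms(3,4)[THEN sets_eq_imp_space_eq] by auto
  have c2: "measure N2 UNIV = c"
    using char[of 0] sp by (simp add: char_def c_def)
  have em: "emeasure N1 UNIV = ennreal c" "emeasure N2 UNIV = ennreal c"
    using c2 by (simp_all add: c_def N1.emeasure_eq_measure N2.emeasure_eq_measure)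
  show ?thesis
  proof (cases "c = 0")
    case True
    have "emeasure N1 A = emeasure N2 A" for A
    proof -
      have "emeasure N1 A \<le> emeasure N1 UNIV" "emeasure N2 A \<le> emeasure N2 UNIV"
        by (rule emeasure_mono; simp add: assms)+
      then show ?thesis
        using em True by simp
    qed
    then show ?thesis
      by (intro measure_eqI) (simp_all add: assms)
  next
    case False
    then have c: "c > 0"
      using measure_nonneg[of N1 UNIV] unfolding c_def by linarith
    let ?D = "\<lambda>N. density N (\<lambda>_. ennreal (1 / c))"
    have rd: "real_distribution (?D N)"
      if [measurable_cong]: "sets N = sets borel" and "emeasure N UNIV = ennreal c" for N
    proof -
      have sp: "space N = UNIV" using that(1)[THEN sets_eq_imp_space_eq] by auto
      have "emeasure (?D N) (space (?D N)) = ennreal (1 / c) * ennreal c"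
        using that sp by (simp add: emeasure_density_const)
      also have "\<dots> = 1" using c by (subst ennreal_mult[symmetric]) auto
      finally show ?thesis
        using that by (simp add: real_distribution_def real_distribution_axioms_def prob_spaceI)
    qed
    have ch: "char (?D N) t = (1 / c) *\<^sub>R char N t" if [measurable_cong]: "sets N = sets borel" for N t
      unfolding char_def using c by (subst integral_density) auto
    have eq: "?D N1 = ?D N2"
      using rd[OF assms(3) em(1)] rd[OF assms(4) em(2)]
    proof (rule Levy_uniqueness)
      show "char (?D N1) = char (?D N2)"
        by (intro ext) (simp only: ch[OF assms(3)] ch[OF assms(4)] char)
    qed
    have "emeasure N1 A = emeasure N2 A" if "A \<in> sets N1" for A
    proof -
      have "ennreal (1 / c) * emeasure N1 A = ennreal (1 / c) * emeasure N2 A"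
        using arg_cong[OF eq, of "\<lambda>N. emeasure N A"] that assms(3,4)
        by (simp add: emeasure_density_const)
      then show ?thesis
        using c by (subst (asm) ennreal_mult_cancel_left) auto
    qed
    then show ?thesis
      by (intro measure_eqI) (simp_all add: assms)
  qed
qed

text \<open>
  The inductive step that turns equal characteristic functions into equal measures. Restricting to the
  slice \<open>{x. inner u x \<in> A}\<close> needs the uniqueness theorem on the line for the complex measure
  \<open>1_C exp(i<v,x>) d\<mu>\<close> pushed forward along \<open>inner u\<close>. It is reduced to positive measures by the weights
  \<open>1_C (1 + Re (c exp(i<v,x>)))\<close> with \<open>|c| \<le> 1\<close>: their push-forwards are finite measures whose
  characteristic functions are combinations of the integrals assumed equal, by
  \<open>Re z = (z + cnj z) / 2\<close>. The choices \<open>c = 0, 1, -i\<close> then recover mass, real part and imaginary part.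
\<close>
lemma char_eq_on_slice:
  fixes \<mu> \<nu> :: "'h::{real_inner,second_countable_topology} measure"
  assumes "prob_space \<mu>" "prob_space \<nu>"
    and [measurable_cong]: "sets \<mu> = sets borel" "sets \<nu> = sets borel"
    and [measurable]: "C \<in> sets borel" "A \<in> sets borel"
    and agree: "\<And>v. (CLINT x|\<mu>. indicat_real C x *\<^sub>R iexp (inner v x))
                   = (CLINT x|\<nu>. indicat_real C x *\<^sub>R iexp (inner v x))"
  shows "(CLINT x|\<mu>. indicat_real (C \<inter> {x. inner u x \<in> A}) x *\<^sub>R iexp (inner v x))
       = (CLINT x|\<nu>. indicat_real (C \<inter> {x. inner u x \<in> A}) x *\<^sub>R iexp (inner v x))"
proof -
  let ?I = "\<lambda>\<rho> v. (CLINT x|\<rho>. indicat_real C x *\<^sub>R iexp (inner v x))"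
  let ?J = "\<lambda>\<rho>. (CLINT x|\<rho>. indicat_real (C \<inter> {x. inner u x \<in> A}) x *\<^sub>R iexp (inner v x))"
  let ?m = "\<lambda>\<rho>. measure \<rho> (C \<inter> {x. inner u x \<in> A})"
  \<comment> \<open>\<open>|c| \<le> 1\<close> keeps the weight nonnegative.\<close>
  define W where "W c x = indicat_real C x * (1 + Re (c * iexp (inner v x)))" for c :: complex and x
  have W_meas [measurable]: "W c \<in> borel_measurable borel" for c
    unfolding W_def by measurable
  have Re_bd: "\<bar>Re (c * iexp (inner v x))\<bar> \<le> 1" if "norm c \<le> 1" for c x
    using abs_Re_le_cmod[of "c * iexp (inner v x)"] that by (simp add: norm_mult)
  have W_nonneg: "0 \<le> W c x" if "norm c \<le> 1" for c x
    unfolding W_def using Re_bd[OF that, of x] by auto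
  have W_le: "\<bar>W c x\<bar> \<le> 2" if "norm c \<le> 1" for c x
    unfolding W_def using Re_bd[OF that, of x] by (auto simp: indicator_def)
  \<comment> \<open>The marginal along \<open>u\<close> of the measure weighted by \<open>W c\<close>.\<close>
  define N where "N \<rho> c = distr (density \<rho> (W c)) borel (\<lambda>x. inner u x)" for \<rho> c
  have facts: "finite_measure (N \<rho> c)"
      "\<And>t. char (N \<rho> c) t = ?I \<rho> (t *\<^sub>R u) + (c / 2) * ?I \<rho> (t *\<^sub>R u + v) + (cnj c / 2) * ?I \<rho> (t *\<^sub>R u - v)"
      "measure (N \<rho> c) A = ?m \<rho> + Re (c * ?J \<rho>)"
    if "prob_space \<rho>" and [measurable_cong]: "sets \<rho> = sets borel" and c: "norm c \<le> 1" for \<rho> c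
  proof -
    interpret \<rho>: prob_space \<rho> by fact
    have spr: "space \<rho> = UNIV" using that(2)[THEN sets_eq_imp_space_eq] by simp
    have W_int: "integrable \<rho> (W c)"
      by (rule \<rho>.integrable_const_bound[where B=2]) (use W_le[OF c] in auto)
    have "finite_measure (density \<rho> (W c))"
      by (rule finite_measureI)
         (use W_int W_nonneg[OF c] in \<open>simp add: emeasure_density nn_integral_eq_integral cong: nn_integral_cong\<close>)
    then show "finite_measure (N \<rho> c)"
      unfolding N_def by (rule finite_measure.finite_measure_distr) simp
    have I: "integrable \<rho> (\<lambda>x. indicat_real D x *\<^sub>R iexp (inner v x))" if [measurable]: "D \<in> sets borel" for v D
      by (rule \<rho>.integrable_const_bound[where B=1]) (auto simp: indicator_def)
    show "char (N \<rho> c) t = ?I \<rho> (t *\<^sub>R u) + (c / 2) * ?I \<rho> (t *\<^sub>R u + v) + (cnj c / 2) * ?I \<rho> (t *\<^sub>R u - v)" for t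
    proof -
      have "char (N \<rho> c) t = (CLINT x|\<rho>. W c x *\<^sub>R iexp (t * inner u x))"
        unfolding char_def N_def using W_nonneg[OF c]
        by (subst integral_distr, simp, simp) (subst integral_density; simp)
      also have "\<dots> = (CLINT x|\<rho>. indicat_real C x *\<^sub>R iexp (inner (t *\<^sub>R u) x)
           + (c / 2) * (indicat_real C x *\<^sub>R iexp (inner (t *\<^sub>R u + v) x))
           + (cnj c / 2) * (indicat_real C x *\<^sub>R iexp (inner (t *\<^sub>R u - v) x)))"
      proof (rule Bochner_Integration.integral_cong[OF refl])
        fix x
        have "complex_of_real (Re (c * iexp (inner v x)))
            = (c * iexp (inner v x) + cnj c * iexp (- inner v x)) / 2"
          by (simp add: complex_eq_iff Re_exp Im_exp)
        then have "W c x *\<^sub>R iexp (t * inner u x) = indicat_real C x *\<^sub>R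
          (iexp (t * inner u x) * (1 + (c * iexp (inner v x) + cnj c * iexp (- inner v x)) / 2))"
          unfolding W_def by (simp add: scaleR_conv_of_real)
        also have "iexp (t * inner u x) * (1 + (c * iexp (inner v x) + cnj c * iexp (- inner v x)) / 2)
          = iexp (t * inner u x) + c / 2 * iexp (t * inner u x + inner v x)
            + cnj c / 2 * iexp (t * inner u x - inner v x)"
          by (simp add: distrib_left exp_add exp_diff exp_minus field_simps)
        finally show "W c x *\<^sub>R iexp (t * inner u x) =
          indicat_real C x *\<^sub>R iexp (inner (t *\<^sub>R u) x)
           + (c / 2) * (indicat_real C x *\<^sub>R iexp (inner (t *\<^sub>R u + v) x))
           + (cnj c / 2) * (indicat_real C x *\<^sub>R iexp (inner (t *\<^sub>R u - v) x))"
          by (simp add: inner_add_left inner_diff_left scaleR_add_right)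
      qed
      also have "\<dots> = ?I \<rho> (t *\<^sub>R u) + (c / 2) * ?I \<rho> (t *\<^sub>R u + v) + (cnj c / 2) * ?I \<rho> (t *\<^sub>R u - v)"
      proof -
        have "(CLINT x|\<rho>. f x + a * g x + b * h x) = integral\<^sup>L \<rho> f + a * integral\<^sup>L \<rho> g + b * integral\<^sup>L \<rho> h"
          if "integrable \<rho> f" "integrable \<rho> g" "integrable \<rho> h" for f g h and a b :: complex
          using that by simp
        then show ?thesis by this (rule I; simp)+
      qed
      finally show ?thesis .
    qed
    have "measure (N \<rho> c) A = (\<integral>y. indicat_real A y \<partial>N \<rho> c)"
      by (simp add: N_def)
    also have "\<dots> = (\<integral>x. W c x * indicat_real A (inner u x) \<partial>\<rho>)"
      unfolding N_def using W_nonneg[OF c]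
      by (subst integral_distr, simp, simp) (subst integral_density; simp)
    also have "\<dots> = (\<integral>x. indicat_real (C \<inter> {x. inner u x \<in> A}) x
        + Re (c * (indicat_real (C \<inter> {x. inner u x \<in> A}) x *\<^sub>R iexp (inner v x))) \<partial>\<rho>)"
      by (rule Bochner_Integration.integral_cong) (auto simp: W_def indicator_def)
    also have "\<dots> = ?m \<rho> + Re (c * ?J \<rho>)"
    proof -
      have "(\<integral>x. f x + Re (c * g x) \<partial>\<rho>) = integral\<^sup>L \<rho> f + Re (c * integral\<^sup>L \<rho> g)"
        if "integrable \<rho> f" and g: "complex_integrable \<rho> g" for f g
      proof -
        have "complex_integrable \<rho> (\<lambda>x. c * g x)" using g by simp
        then show ?thesis
          using that(1) integral_Re[of \<rho> "\<lambda>x. c * g x"]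
          by (simp only: Bochner_Integration.integral_add integrable_Re integral_mult_right_zero)
      qed
      note this[OF _ I]
      moreover have "integrable \<rho> (indicat_real (C \<inter> {x. inner u x \<in> A}))"
        by (rule \<rho>.integrable_const_bound[where B=1]) auto
      moreover have "(\<integral>x. indicat_real (C \<inter> {x. inner u x \<in> A}) x \<partial>\<rho>) = ?m \<rho>"
        by (simp add: spr)
      ultimately show ?thesis by simp
    qed
    finally show "measure (N \<rho> c) A = ?m \<rho> + Re (c * ?J \<rho>)" .
  qed
  have key: "?m \<mu> + Re (c * ?J \<mu>) = ?m \<nu> + Re (c * ?J \<nu>)" if c: "norm c \<le> 1" for c
  proof -
    have "N \<mu> c = N \<nu> c"
    proof (rule finite_measure_eq_if_char_eq)
      show "char (N \<mu> c) t = char (N \<nu> c) t" for t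
        unfolding facts(2)[OF assms(1,3) c] facts(2)[OF assms(2,4) c] agree ..
    qed (use facts(1)[OF assms(1,3) c] facts(1)[OF assms(2,4) c] in \<open>simp_all add: N_def\<close>)
    then show ?thesis
      using facts(3)[OF assms(1,3) c] facts(3)[OF assms(2,4) c] by simp
  qed
  \<comment> \<open>\<open>c = 0\<close> gives equal masses, so these cancel in the cases \<open>c = 1\<close> (real part) and \<open>c = -i\<close> (imaginary part).\<close>
  from key[of 0] key[of 1] key[of "-\<i>"] show ?thesis
    by (simp add: complex_eq_iff)
qed

text \<open>
  Finite intersections of slices, built one slice at a time so that \<open>char_eq_on_slice\<close> is exactly the
  induction step.
\<close>
inductive_set cylinders :: "'h::real_inner set set" where
  UNIV: "UNIV \<in> cylinders"
| slice: "C \<in> cylinders \<Longrightarrow> A \<in> sets borel \<Longrightarrow> C \<inter> {x. inner u x \<in> A} \<in> cylinders"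

lemma Int_cylinders: "D \<in> cylinders \<Longrightarrow> C \<in> cylinders \<Longrightarrow> C \<inter> D \<in> cylinders"
  by (induction rule: cylinders.induct) (auto simp: Int_assoc[symmetric] intro: cylinders.slice)

lemma cylinders_borel: "C \<in> cylinders \<Longrightarrow> C \<in> sets borel"
proof (induction rule: cylinders.induct)
  case (slice C A u)
  then have [measurable]: "C \<in> sets borel" "A \<in> sets borel" by auto
  have [measurable]: "inner u \<in> borel_measurable borel"
    by (intro borel_measurable_continuous_onI continuous_intros)
  show ?case by measurable
qed simp

text \<open>
  A point outside the ball is separated from it by a half-space with normal \<open>x - a\<close>. The set of
  separating normals is open, so it contains one from the dense set \<open>D\<close>.
\<close>
lemma cball_eq_halfspaces:
  fixes a :: "'h::real_inner"
  assumes D: "\<And>U. open U \<Longrightarrow> U \<noteq> {} \<Longrightarrow> \<exists>d\<in>D. d \<in> U" and "0 \<le> r"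
  shows "cball a r = (\<Inter>d\<in>D. {x. inner d x \<le> inner d a + r * norm d})"
proof (intro set_eqI iffI)
  fix x assume x: "x \<in> cball a r"
  have "inner d (x - a) \<le> r * norm d" for d
  proof -
    have "inner d (x - a) \<le> norm d * norm (x - a)" by (rule norm_cauchy_schwarz)
    also have "\<dots> \<le> norm d * r"
      using x by (intro mult_left_mono) (auto simp: dist_norm norm_minus_commute)
    finally show ?thesis by (simp add: mult.commute)
  qed
  then show "x \<in> (\<Inter>d\<in>D. {x. inner d x \<le> inner d a + r * norm d})"
    by (auto simp: inner_diff_right algebra_simps)
next
  fix x assume x: "x \<in> (\<Inter>d\<in>D. {x. inner d x \<le> inner d a + r * norm d})"
  show "x \<in> cball a r"
  proof (rule ccontr)
    assume n: "x \<notin> cball a r"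
    let ?U = "{d. r * norm d < inner d (x - a)}"
    have "open ?U"
      by (intro open_Collect_less continuous_intros)
    have "x \<noteq> a" using n \<open>0 \<le> r\<close> by auto
    then have "r * norm (x - a) < norm (x - a) * norm (x - a)"
      using n by (intro mult_strict_right_mono) (auto simp: dist_norm norm_minus_commute)
    then have "x - a \<in> ?U" by (simp add: power2_norm_eq_inner[symmetric] power2_eq_square)
    then obtain d where "d \<in> D" "d \<in> ?U"
      using D[OF \<open>open ?U\<close>] by blast
    then show False using x by (auto simp: inner_diff_right)
  qed
qed

lemma sigma_sets_cylinders:
  "sigma_sets UNIV cylinders = sets (borel :: 'h::{real_inner,second_countable_topology} measure)"
proof
  show "sigma_sets UNIV cylinders \<subseteq> sets (borel :: 'h measure)"
    using cylinders_borel sets.sigma_sets_subset[of cylinders borel] by auto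
next
  define S where "S = sigma UNIV (cylinders :: 'h set set)"
  have S: "sets S = sigma_sets UNIV cylinders" "space S = UNIV"
    by (simp_all add: S_def)
  obtain D :: "'h set" where D: "countable D" "\<And>U. open U \<Longrightarrow> U \<noteq> {} \<Longrightarrow> \<exists>d\<in>D. d \<in> U"
    using countable_dense_exists by metis
  have half: "{x. inner u x \<le> r} \<in> sets S" for u :: 'h and r
    using cylinders.slice[OF cylinders.UNIV, of "{..r}" u] by (auto simp: S atMost_def)
  have cball: "cball a r \<in> sets S" if "0 \<le> r" for a :: 'h and r
  proof -
    have "cball a r = (\<Inter>d\<in>D. {x. inner d x \<le> inner d a + r * norm d})"
      by (rule cball_eq_halfspaces) (use D(2) that in auto)
    moreover have "UNIV \<in> sets S"
      using sets.top[of S] S(2) by simp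
    ultimately show ?thesis
      using sets.countable_INT''[of S D "\<lambda>d. {x. inner d x \<le> inner d a + r * norm d}"] D(1) half
      by simp
  qed
  have "U \<in> sets S" if "open U" for U :: "'h set"
  proof -
    let ?I = "{(d, m). d \<in> D \<and> cball d (1 / real (Suc m)) \<subseteq> U}"
    have "U \<subseteq> (\<Union>(d, m)\<in>?I. cball d (1 / real (Suc m)))"
    proof
      fix x assume "x \<in> U"
      then obtain e where e: "e > 0" "cball x e \<subseteq> U"
        using \<open>open U\<close> unfolding open_contains_cball by metis
      obtain m where m: "1 / real (Suc m) < e / 2"
        using nat_approx_posE[of "e / 2"] e(1) by (metis half_gt_zero of_nat_Suc)
      obtain d where d: "d \<in> D" "d \<in> ball x (1 / real (Suc m))"
        using D(2)[of "ball x (1 / real (Suc m))"] by auto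
      have "cball d (1 / real (Suc m)) \<subseteq> cball x e"
      proof
        fix y assume "y \<in> cball d (1 / real (Suc m))"
        then have "dist x y < e" using d m dist_triangle[of x y d] unfolding mem_cball mem_ball by linarith
        then show "y \<in> cball x e" by simp
      qed
      then show "x \<in> (\<Union>(d, m)\<in>?I. cball d (1 / real (Suc m)))"
        using d e by (intro UN_I[of "(d, m)"]) (auto simp: dist_commute)
    qed
    then have "U = (\<Union>(d, m)\<in>?I. cball d (1 / real (Suc m)))" by blast
    moreover have "countable ?I"
      by (rule countable_subset[of _ "D \<times> UNIV"]) (use D(1) in auto)
    then have "(\<Union>(d, m)\<in>?I. cball d (1 / real (Suc m))) \<in> sets S"
      by (intro sets.countable_UN') (auto intro: cball)
    ultimately show ?thesis by simp
  qed
  then have "sigma_sets UNIV (Collect open) \<subseteq> sets S"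
    using sets.sigma_sets_subset[of "Collect open" S] S(2) by auto
  then show "sets (borel :: 'h measure) \<subseteq> sigma_sets UNIV cylinders"
    by (simp add: borel_def S)
qed

text \<open>
  The marginals determine the characteristic functional, and induction over the cylinders passes from there
  to the measures of all cylinders, a generating family closed under intersection.
\<close>
lemma measure_eq_if_projections_eq:
  fixes \<mu> \<nu> :: "'h::{real_inner,second_countable_topology} measure"
  assumes "prob_space \<mu>" "prob_space \<nu>"
    and sets: "sets \<mu> = sets borel" "sets \<nu> = sets borel"
    and proj: "\<And>u. distr \<mu> borel (inner u) = distr \<nu> borel (inner u)"
  shows "\<mu> = \<nu>"
proof -
  interpret \<mu>: prob_space \<mu> by fact
  interpret \<nu>: prob_space \<nu> by fact
  note [measurable_cong] = sets
  have sp: "space \<mu> = UNIV" "space \<nu> = UNIV"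
    using sets[THEN sets_eq_imp_space_eq] by auto
  have char: "(CLINT x|\<rho>. iexp (inner v x)) = char (distr \<rho> borel (inner v)) 1"
    if [measurable_cong]: "sets \<rho> = sets borel" for \<rho> and v :: 'h
    by (simp add: char_def integral_distr)
  have agree: "(CLINT x|\<mu>. indicat_real C x *\<^sub>R iexp (inner v x))
             = (CLINT x|\<nu>. indicat_real C x *\<^sub>R iexp (inner v x))" if "C \<in> cylinders" for C v
    using that
  proof (induction arbitrary: v rule: cylinders.induct)
    case UNIV
    then show ?case by (simp add: char sets proj)
  next
    case (slice C A u)
    show ?case
      by (rule char_eq_on_slice) (use assms slice cylinders_borel in auto)
  qed
  \<comment> \<open>The integrals at frequency \<open>0\<close> are the measures themselves.\<close>
  have "measure \<mu> C = measure \<nu> C" if "C \<in> cylinders" for C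
    using agree[OF that, of 0] that cylinders_borel[OF that]
    by (simp add: sp scaleR_conv_of_real del: of_real_indicator)
  then have "emeasure \<mu> C = emeasure \<nu> C" if "C \<in> cylinders" for C
    using that by (simp add: \<mu>.emeasure_eq_measure \<nu>.emeasure_eq_measure)
  then show ?thesis
    by (intro measure_eqI_generator_eq[where E=cylinders and \<Omega>=UNIV and A="\<lambda>_. UNIV"])
       (auto simp: sigma_sets_cylinders sets Int_stable_def intro: Int_cylinders cylinders.UNIV)
qed

section \<open>Centered Gaussian laws are determined by their covariance\<close>

lemma centered_normal_second_moment: "(\<integral>x. x\<^sup>2 \<partial>centered_normal s) = s\<^sup>2"
proof -
  have "(\<integral>x. x\<^sup>2 \<partial>centered_normal s) = (\<integral>x. std_normal_density x * (s * x)\<^sup>2 \<partial>lborel)"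
    unfolding centered_normal_def
    by (subst integral_distr, simp, simp, subst integral_density) simp_all
  also have "\<dots> = s\<^sup>2 * (\<integral>x. std_normal_density x * x ^ (2 * 1) \<partial>lborel)"
    by (subst integral_mult_right_zero[symmetric], rule Bochner_Integration.integral_cong)
       (simp_all add: power_mult_distrib)
  also have "\<dots> = s\<^sup>2"
    by (simp only: integral_std_normal_moment_even) simp
  finally show ?thesis .
qed

lemma centered_gaussian_projection:
  fixes \<mu> :: "'h::{real_inner,second_countable_topology} measure"
  assumes "centered_gaussian \<mu>" "has_covariance \<mu> C"
  shows "distr \<mu> borel (inner u) = centered_normal (sqrt (inner u (C u)))"
proof -
  have [measurable_cong]: "sets \<mu> = sets borel"
    using assms(1) by (simp add: centered_gaussian_def)
  obtain s where s: "s \<ge> 0" "distr \<mu> borel (inner u) = centered_normal s"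
    using assms(1) unfolding centered_gaussian_def by blast
  have "s\<^sup>2 = (\<integral>x. x\<^sup>2 \<partial>distr \<mu> borel (inner u))"
    by (simp add: s(2) centered_normal_second_moment)
  also have "\<dots> = (\<integral>x. inner u x * inner u x \<partial>\<mu>)"
    by (subst integral_distr) (simp_all add: power2_eq_square)
  also have "\<dots> = inner u (C u)"
    using assms(2) by (simp add: has_covariance_def)
  finally show ?thesis
    using s by (metis real_sqrt_unique)
qed

lemma centered_gaussian_eq_if_covariance_eq:
  fixes \<mu> \<nu> :: "'h::{real_inner,second_countable_topology} measure"
  assumes "centered_gaussian \<mu>" "centered_gaussian \<nu>" "has_covariance \<mu> C" "has_covariance \<nu> C"
  shows "\<mu> = \<nu>"
proof (rule measure_eq_if_projections_eq)
  show "distr \<mu> borel (inner u) = distr \<nu> borel (inner u)" for u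
    using assms by (simp only: centered_gaussian_projection)
qed (use assms(1,2) in \<open>simp_all only: centered_gaussian_def\<close>)

section \<open>Measurability of the ridge estimator\<close>

text \<open>
  By the midpoint inequality \<open>c |f - g|^2\<close> is at most the mean excess of \<open>J f\<close> and \<open>J g\<close> over the
  infimum \<open>m\<close>. So a minimising sequence is Cauchy, its limit attains \<open>m\<close>, and every other minimiser has
  distance \<open>0\<close> from it; in particular \<open>arg_min\<close> is this limit.
\<close>
lemma minimizing_sequence_tendsto_arg_min:
  fixes J :: "'h::{real_normed_vector,complete_space} \<Rightarrow> real"
  assumes cont: "continuous_on UNIV J" and lower: "\<And>f. m \<le> J f"
    and conv: "\<And>f g. J ((1/2) *\<^sub>R (f + g)) + c * (norm (f - g))\<^sup>2 \<le> (J f + J g) / 2" and "c > 0"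
    and x: "(\<lambda>i. J (x i)) \<longlonglongrightarrow> m"
  shows "x \<longlonglongrightarrow> arg_min J (\<lambda>_. True)"
proof -
  have close: "c * (norm (f - g))\<^sup>2 \<le> (J f + J g) / 2 - m" for f g
    using conv[of f g] lower[of "(1/2) *\<^sub>R (f + g)"] by linarith
  have "Cauchy x"
  proof (rule metric_CauchyI)
    fix e :: real assume "e > 0"
    then have "c * e\<^sup>2 > 0" using \<open>c > 0\<close> by simp
    then have "\<forall>\<^sub>F i in sequentially. J (x i) < m + c * e\<^sup>2"
      by (intro order_tendstoD(2)[OF x]) simp
    then obtain N where N: "\<And>i. i \<ge> N \<Longrightarrow> J (x i) < m + c * e\<^sup>2"
      unfolding eventually_sequentially by blast
    have "dist (x i) (x j) < e" if "i \<ge> N" "j \<ge> N" for i j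
    proof -
      have "c * (norm (x i - x j))\<^sup>2 < c * e\<^sup>2"
        using close[of "x i" "x j"] N[OF that(1)] N[OF that(2)] by (simp add: field_simps)
      then have "(norm (x i - x j))\<^sup>2 < e\<^sup>2" using \<open>c > 0\<close> by simp
      then show ?thesis
        using \<open>e > 0\<close> by (simp add: dist_norm power_less_imp_less_base)
    qed
    then show "\<exists>N. \<forall>i\<ge>N. \<forall>j\<ge>N. dist (x i) (x j) < e" by blast
  qed
  then obtain a where a: "x \<longlonglongrightarrow> a"
    using Cauchy_convergent convergent_def by blast
  have "(\<lambda>i. J (x i)) \<longlonglongrightarrow> J a"
    using cont a by (auto simp: continuous_on_eq_continuous_at intro: isCont_tendsto_compose)
  then have Ja: "J a = m"
    using x LIMSEQ_unique by blast
  have "J (arg_min J (\<lambda>_. True)) = m"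
    using arg_min_equality[of "\<lambda>_. True" a J] lower Ja by simp
  then have "c * (norm (arg_min J (\<lambda>_. True) - a))\<^sup>2 \<le> 0"
    using close[of "arg_min J (\<lambda>_. True)" a] Ja by simp
  then have "arg_min J (\<lambda>_. True) = a"
    using \<open>c > 0\<close> by (simp add: mult_le_0_iff)
  then show ?thesis using a by simp
qed

text \<open>
  The minimiser is a limit of near-minimisers taken from a countable dense set. Picking the first point of
  an enumeration that is optimal up to \<open>1 / (k + 1)\<close> among all enumerated points involves only countably
  many comparisons of the measurable functions \<open>\<lambda>w. J w f\<close>.
\<close>
lemma borel_measurable_arg_min:
  fixes J :: "'w \<Rightarrow> 'h::{real_normed_vector,complete_space,second_countable_topology} \<Rightarrow> real"
  assumes J_meas [measurable]: "\<And>f. (\<lambda>w. J w f) \<in> borel_measurable M"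
    and cont: "\<And>w. w \<in> space M \<Longrightarrow> continuous_on UNIV (J w)"
    and nonneg: "\<And>w f. w \<in> space M \<Longrightarrow> 0 \<le> J w f"
    and conv: "\<And>w f g. w \<in> space M \<Longrightarrow>
      J w ((1/2) *\<^sub>R (f + g)) + c * (norm (f - g))\<^sup>2 \<le> (J w f + J w g) / 2"
    and "c > 0"
  shows "(\<lambda>w. arg_min (J w) (\<lambda>_. True)) \<in> borel_measurable M"
proof -
  obtain D :: "'h set" where D: "countable D" "\<And>U. open U \<Longrightarrow> U \<noteq> {} \<Longrightarrow> \<exists>d\<in>D. d \<in> U"
    using countable_dense_exists by metis
  then have "D \<noteq> {}" by blast
  define e where "e = from_nat_into D"
  have e: "\<exists>i. e i \<in> U" if U: "open U" "U \<noteq> {}" for U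
    using D(2)[OF U] from_nat_into_surj[OF D(1)] unfolding e_def by metis
  define N where "N k w = (LEAST i. \<forall>j. J w (e i) \<le> J w (e j) + 1 / real (Suc k))" for k w
  have [measurable]: "(\<lambda>w. N k w) \<in> M \<rightarrow>\<^sub>M count_space UNIV" for k
    unfolding N_def by measurable
  have meas: "(\<lambda>w. e (N k w)) \<in> borel_measurable M" for k
    by measurable
  show ?thesis
  proof (rule borel_measurable_LIMSEQ_metric[OF meas])
    fix w assume w: "w \<in> space M"
    define m where "m = (INF f. J w f)"
    have bdd: "bdd_below (range (J w))"
      by (rule bdd_belowI2[where m=0]) (rule nonneg[OF w])
    have lower: "m \<le> J w f" for f
      unfolding m_def by (rule cINF_lower[OF bdd]) simp
    have near: "\<exists>i. J w (e i) < m + \<epsilon>" if "\<epsilon> > 0" for \<epsilon>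
    proof -
      have "open {f. J w f < m + \<epsilon>}"
        using cont[OF w] by (intro open_Collect_less) auto
      moreover have "{f. J w f < m + \<epsilon>} \<noteq> {}"
        using cINF_less_iff[OF _ bdd, of "m + \<epsilon>"] that unfolding m_def by auto
      ultimately show ?thesis
        using e by blast
    qed
    have upper: "J w (e (N k w)) \<le> m + 1 / real (Suc k)" for k
    proof -
      have "\<exists>i. \<forall>j. J w (e i) \<le> J w (e j) + 1 / real (Suc k)"
      proof -
        obtain i where "J w (e i) < m + 1 / real (Suc k)"
          using near[of "1 / real (Suc k)"] by auto
        then have "J w (e i) \<le> J w (e j) + 1 / real (Suc k)" for j
          using lower[of "e j"] by linarith
        then show ?thesis by blast
      qed
      then have N: "J w (e (N k w)) \<le> J w (e j) + 1 / real (Suc k)" for j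
        unfolding N_def by (rule LeastI2_ex) blast
      show ?thesis
      proof (rule field_le_epsilon)
        fix \<epsilon> :: real assume "\<epsilon> > 0"
        then obtain j where "J w (e j) < m + \<epsilon>" using near by blast
        then show "J w (e (N k w)) \<le> m + 1 / real (Suc k) + \<epsilon>" using N[of j] by linarith
      qed
    qed
    have "(\<lambda>k. J w (e (N k w))) \<longlonglongrightarrow> m"
    proof (rule tendsto_sandwich[of "\<lambda>_. m" _ _ "\<lambda>k. m + 1 / real (Suc k)"])
      show "(\<lambda>k. m + 1 / real (Suc k)) \<longlonglongrightarrow> m"
        using tendsto_add[OF tendsto_const[of m] LIMSEQ_inverse_real_of_nat] by (simp add: inverse_eq_divide)
    qed (intro always_eventually allI lower upper tendsto_const)+
    then show "(\<lambda>k. e (N k w)) \<longlonglongrightarrow> arg_min (J w) (\<lambda>_. True)"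
      by (intro minimizing_sequence_tendsto_arg_min[OF cont[OF w] lower conv[OF w] \<open>c > 0\<close>])
  qed
qed

text \<open>
  The parallelogram law, which makes the ridge penalty \<open>lam |f|^2\<close> uniformly midpoint convex with constant
  \<open>lam / 4\<close>.
\<close>
lemma midpoint_square:
  fixes f g :: "'h::real_inner"
  shows "(norm ((1/2) *\<^sub>R (f + g)))\<^sup>2 + (1/4) * (norm (f - g))\<^sup>2 = ((norm f)\<^sup>2 + (norm g)\<^sup>2) / 2"
  by (simp add: power2_norm_eq_inner inner_add inner_diff inner_commute field_simps)

lemma borel_measurable_ridge:
  fixes K :: "'s::topological_space \<Rightarrow> 'h::{real_inner,banach,second_countable_topology}"
  assumes [measurable]: "K \<in> borel_measurable borel" and "lam > 0"
    and d [measurable]: "\<And>i. i \<in> {1..n} \<Longrightarrow> (\<lambda>w. fst (d w i)) \<in> borel_measurable M"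
        "\<And>i. i \<in> {1..n} \<Longrightarrow> (\<lambda>w. snd (d w i)) \<in> borel_measurable M"
  shows "(\<lambda>w. ridge K n lam (d w)) \<in> borel_measurable M"
  unfolding ridge_def
proof (rule borel_measurable_arg_min[where c="lam / 4"])
  show "(\<lambda>w. emp_mean n (\<lambda>i. (snd (d w i) - rkhs_eval K f (fst (d w i)))\<^sup>2) + lam * (norm f)\<^sup>2)
      \<in> borel_measurable M" for f
    unfolding emp_mean_def rkhs_eval_def by measurable
next
  fix w f g
  let ?a = "\<lambda>f i. snd (d w i) - rkhs_eval K f (fst (d w i))"
  have "emp_mean n (\<lambda>i. (?a ((1/2) *\<^sub>R (f + g)) i)\<^sup>2)
      \<le> emp_mean n (\<lambda>i. ((?a f i)\<^sup>2 + (?a g i)\<^sup>2) / 2)"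
    unfolding emp_mean_def
  proof (intro scaleR_left_mono sum_mono)
    fix i
    have "?a ((1/2) *\<^sub>R (f + g)) i = (?a f i + ?a g i) / 2"
      by (simp add: rkhs_eval_def inner_add_left field_simps)
    moreover have "(p\<^sup>2 + q\<^sup>2) / 2 - ((p + q) / 2)\<^sup>2 = ((p - q) / 2)\<^sup>2" for p q :: real
      by (simp add: power2_eq_square field_simps)
    then have "((p + q) / 2)\<^sup>2 \<le> (p\<^sup>2 + q\<^sup>2) / 2" for p q :: real
      by (metis diff_ge_0_iff_ge zero_le_power2)
    ultimately show "(?a ((1/2) *\<^sub>R (f + g)) i)\<^sup>2 \<le> ((?a f i)\<^sup>2 + (?a g i)\<^sup>2) / 2"
      by (simp only:)
  qed simp
  also have "\<dots> = (emp_mean n (\<lambda>i. (?a f i)\<^sup>2) + emp_mean n (\<lambda>i. (?a g i)\<^sup>2)) / 2"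
    by (simp add: emp_mean_def sum.distrib sum_divide_distrib[symmetric] add_divide_distrib)
  finally show "emp_mean n (\<lambda>i. (?a ((1/2) *\<^sub>R (f + g)) i)\<^sup>2) + lam * (norm ((1/2) *\<^sub>R (f + g)))\<^sup>2
        + lam / 4 * (norm (f - g))\<^sup>2
      \<le> (emp_mean n (\<lambda>i. (?a f i)\<^sup>2) + lam * (norm f)\<^sup>2
          + (emp_mean n (\<lambda>i. (?a g i)\<^sup>2) + lam * (norm g)\<^sup>2)) / 2"
    using arg_cong[OF midpoint_square[of f g], of "\<lambda>x. lam * x"] by (simp add: algebra_simps)
next
  show "continuous_on UNIV
      (\<lambda>f. emp_mean n (\<lambda>i. (snd (d w i) - rkhs_eval K f (fst (d w i)))\<^sup>2) + lam * (norm f)\<^sup>2)" for w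
    unfolding emp_mean_def rkhs_eval_def by (intro continuous_intros)
next
  show "0 \<le> emp_mean n (\<lambda>i. (snd (d w i) - rkhs_eval K f (fst (d w i)))\<^sup>2) + lam * (norm f)\<^sup>2" for w f
    using \<open>lam > 0\<close> unfolding emp_mean_def
    by (intro add_nonneg_nonneg scaleR_nonneg_nonneg sum_nonneg mult_nonneg_nonneg) auto
qed (use \<open>lam > 0\<close> in simp)

section \<open>Comparing distribution functions of close random elements\<close>

lemma continuous_on_if_modulus:
  fixes F :: "'h::real_normed_vector \<Rightarrow> real"
  assumes "modulus_of_continuity \<psi>" "\<And>u v. \<bar>F u - F v\<bar> \<le> \<psi> (norm (u - v))"
  shows "continuous_on UNIV F"
  unfolding continuous_on_iff
proof (intro ballI allI impI)
  fix u and e :: real assume "0 < e"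
  have "\<forall>\<^sub>F r in at_right 0. \<psi> r < e"
    using assms(1) \<open>0 < e\<close> by (intro order_tendstoD(2)[of \<psi> 0]) (simp_all add: modulus_of_continuity_def)
  then obtain d where d: "d > 0" "\<And>r. 0 < r \<Longrightarrow> r < d \<Longrightarrow> \<psi> r < e"
    unfolding eventually_at_right_field by blast
  have "dist (F v) (F u) < e" if "dist v u < d" for v
  proof (cases "v = u")
    case False
    then have "\<psi> (norm (v - u)) < e" using d(2) that by (simp add: dist_norm)
    then show ?thesis using assms(2)[of v u] by (simp add: dist_real_def)
  qed (simp add: \<open>0 < e\<close>)
  then show "\<exists>d>0. \<forall>v\<in>UNIV. dist v u < d \<longrightarrow> dist (F v) (F u) < e"
    using d(1) by blast
qed

lemma (in prob_space) prob_le_except: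
  assumes "A \<in> events" "B \<in> events" "E \<in> events" "A \<inter> E \<subseteq> B" "1 - \<eta> \<le> prob E"
  shows "prob A \<le> prob B + \<eta>"
proof -
  have "prob A \<le> prob (B \<union> (space M - E))"
    using assms sets.sets_into_space[of A M] by (intro finite_measure_mono) auto
  also have "\<dots> \<le> prob B + prob (space M - E)"
    using assms by (intro measure_Un_le) auto
  also have "\<dots> \<le> prob B + \<eta>"
    using assms by (simp add: prob_compl)
  finally show ?thesis .
qed

text \<open>
  The supremum is the concentration function of \<open>V\<close>, the quantity through which anti-concentration enters.
\<close>
lemma (in prob_space) prob_increment_le:
  fixes V :: "'a \<Rightarrow> real"
  assumes [measurable]: "V \<in> borel_measurable M" and "0 \<le> r"
  shows "\<P>(w in M. V w \<le> t + r) \<le> \<P>(w in M. V w \<le> t) + (SUP s. \<P>(w in M. \<bar>V w - s\<bar> \<le> r))"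
proof -
  have "\<P>(w in M. V w \<le> t + r) \<le> prob ({w \<in> space M. V w \<le> t} \<union> {w \<in> space M. \<bar>V w - t\<bar> \<le> r})"
    using \<open>0 \<le> r\<close> by (intro finite_measure_mono) auto
  also have "\<dots> \<le> \<P>(w in M. V w \<le> t) + \<P>(w in M. \<bar>V w - t\<bar> \<le> r)"
    by (intro measure_Un_le) auto
  also have "\<P>(w in M. \<bar>V w - t\<bar> \<le> r) \<le> (SUP s. \<P>(w in M. \<bar>V w - s\<bar> \<le> r))"
    by (intro cSUP_upper bdd_aboveI2[where M=1]) auto
  finally show ?thesis by simp
qed

text \<open>
  Bounds at rational thresholds to the right of \<open>t\<close> pass to \<open>t\<close> because distribution functions are
  right-continuous and nondecreasing.
\<close>
lemma cdf_limit_from_right: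
  fixes V :: "'a \<Rightarrow> real"
  assumes "prob_space N" and [measurable]: "V \<in> borel_measurable N"
    and le: "\<And>q. t < of_rat q \<Longrightarrow> a \<le> \<P>(x in N. V x \<le> of_rat q + r) + c"
  shows "a \<le> \<P>(x in N. V x \<le> t + r) + c"
proof -
  interpret prob_space N by fact
  let ?D = "distr N borel V"
  interpret D: prob_space ?D by (rule prob_space_distr) simp
  interpret D: finite_borel_measure ?D by standard simp
  have cdf: "cdf ?D s = \<P>(x in N. V x \<le> s)" for s
    unfolding cdf_def by (subst measure_distr) (auto intro!: arg_cong[where f=prob])
  have "(cdf ?D \<longlongrightarrow> cdf ?D (t + r)) (at_right (t + r))"
    using D.cdf_is_right_cont[of "t + r"] by (simp add: continuous_within)
  then have lim: "((\<lambda>s. cdf ?D s + c) \<longlongrightarrow> cdf ?D (t + r) + c) (at_right (t + r))"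
    by (intro tendsto_intros)
  have "a \<le> cdf ?D s + c" if s: "t + r < s" for s
  proof -
    have "t < s - r" using s by linarith
    then obtain q where q: "t < of_rat q" "of_rat q < s - r"
      using of_rat_dense by blast
    have "a \<le> cdf ?D (of_rat q + r) + c"
      using le[OF q(1)] by (simp add: cdf)
    also have "cdf ?D (of_rat q + r) \<le> cdf ?D s"
      using q by (intro D.cdf_nondecreasing) simp
    finally show ?thesis by simp
  qed
  then have "\<forall>\<^sub>F s in at_right (t + r). a \<le> cdf ?D s + c"
    by (auto intro: eventually_mono[OF eventually_at_right_less])
  then have "a \<le> cdf ?D (t + r) + c"
    by (rule tendsto_lowerbound[OF lim]) simp
  then show ?thesis by (simp add: cdf)
qed

section \<open>The comparison conditionally on a sub-sigma-algebra\<close>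

text \<open>
  The conditional form of \<open>prob_le_except\<close>: apply the conditional expectation to
  \<open>1_A + 1_E \<le> 1_B + 1\<close>.
\<close>
lemma cond_probability_le_except:
  assumes "prob_space M" "subalgebra M G"
    and [measurable]: "A \<in> sets M" "B \<in> sets M" "E \<in> sets M" and sub: "A \<inter> E \<subseteq> B"
  shows "AE w in M. cond_probability M G A w \<le> cond_probability M G B w + (1 - cond_probability M G E w)"
proof -
  interpret prob_space M by fact
  interpret finite_measure_subalgebra M G by standard fact
  have i: "integrable M (indicat_real C)" if "C \<in> sets M" for C
    using that by (simp add: integrable_indicator_iff emeasure_eq_measure)
  have "AE w in M. real_cond_exp M G (\<lambda>w. indicat_real A w + indicat_real E w) w
      \<le> real_cond_exp M G (\<lambda>w. indicat_real B w + 1) w"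
  proof (rule real_cond_exp_mono)
    show "AE w in M. indicat_real A w + indicat_real E w \<le> indicat_real B w + 1"
      using sub by (auto simp: indicator_def)
  qed (auto intro!: i)
  moreover have "AE w in M. real_cond_exp M G (\<lambda>w. indicat_real A w + indicat_real E w) w
      = real_cond_exp M G (indicat_real A) w + real_cond_exp M G (indicat_real E) w"
    by (intro real_cond_exp_add i) auto
  moreover have "AE w in M. real_cond_exp M G (\<lambda>w. indicat_real B w + 1) w
      = real_cond_exp M G (indicat_real B) w + real_cond_exp M G (\<lambda>_. 1) w"
    by (intro real_cond_exp_add i) auto
  moreover have "AE w in M. real_cond_exp M G (\<lambda>_. 1) w = 1"
    by (rule real_cond_exp_F_meas) auto
  ultimately show ?thesis
    unfolding cond_probability_def by eventually_elim linarith
qed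

text \<open>
  The event witnessing \<open>with_prob\<close> has to lie in \<open>G\<close>, so a null set of \<open>M\<close> may be removed from it only if
  that null set is itself in \<open>G\<close>.
\<close>
lemma with_prob_conj_AE:
  assumes "prob_space M" "subalgebra M G" "with_prob M G p Q"
    and "AE w in M. S w" and S: "{w \<in> space M. S w} \<in> sets G"
  shows "with_prob M G p (\<lambda>w. Q w \<and> S w \<and> w \<in> space M)"
proof -
  interpret prob_space M by fact
  obtain E where E: "E \<in> sets G" "p \<le> measure M E" "\<And>w. w \<in> E \<Longrightarrow> Q w"
    using assms(3) unfolding with_prob_def by blast
  let ?S = "{w \<in> space M. S w}"
  have M: "E \<in> sets M" "?S \<in> sets M"
    using assms(2) E(1) S by (auto simp: subalgebra_def)
  have "measure M (E \<inter> ?S) = measure M E"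
    using M assms(4) by (intro finite_measure_eq_AE) auto
  then show ?thesis
    unfolding with_prob_def using E S by (intro bexI[of _ "E \<inter> ?S"]) auto
qed

lemma with_prob_mono:
  "with_prob M G p Q \<Longrightarrow> (\<And>w. Q w \<Longrightarrow> S w) \<Longrightarrow> with_prob M G p S"
  unfolding with_prob_def by blast

lemma with_prob_ex: "with_prob M G p Q \<Longrightarrow> 0 < p \<Longrightarrow> \<exists>w. Q w"
  unfolding with_prob_def by (metis all_not_in_conv measure_empty not_le)

text \<open>
  An empty event has conditional probability \<open>0\<close> almost surely. This serves to see that a random distance
  is at most \<open>R\<close> somewhere, hence that \<open>R\<close> is nonnegative.
\<close>
lemma cond_probability_event_nonempty:
  assumes "prob_space M" "subalgebra M G" "0 < p" "0 < q"
    and "with_prob M G p (\<lambda>w. q \<le> cond_probability M G A w)"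
  shows "A \<noteq> {}"
proof
  assume A: "A = {}"
  interpret prob_space M by fact
  interpret finite_measure_subalgebra M G by standard fact
  have "AE w in M. cond_probability M G A w = 0"
    unfolding cond_probability_def A using real_cond_exp_F_meas[of "indicat_real {}"] by simp
  moreover have "{w \<in> space M. cond_probability M G A w = 0} \<in> sets G"
  proof -
    have [measurable]: "cond_probability M G A \<in> borel_measurable G"
      unfolding cond_probability_def by (rule borel_measurable_cond_exp)
    have "{w \<in> space G. cond_probability M G A w = 0} \<in> sets G" by measurable
    moreover have "space G = space M" using assms(2) by (simp add: subalgebra_def)
    ultimately show ?thesis by simp
  qed
  ultimately have "\<exists>w. q \<le> cond_probability M G A w \<and> cond_probability M G A w = 0 \<and> w \<in> space M"
    using with_prob_ex[OF with_prob_conj_AE[OF assms(1,2,5)]] assms(3) by blast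
  then show False using \<open>0 < q\<close> by auto
qed

text \<open>
  For a fixed threshold, the conditional probabilities of the events \<open>F U \<le> q\<close> and \<open>F V \<le> q \<plusminus> r\<close>
  are compared by \<open>cond_probability_le_except\<close>, and they agree almost surely with the values of \<open>\<kappa> w\<close> and \<open>\<mu>\<close>.
  Each comparison fails on a null set that depends on the threshold. Over the rational thresholds these sets
  have a null union, and it lies in \<open>G\<close> because all quantities that enter are
  \<open>G\<close>-measurable; right-continuity then reaches the real thresholds.
\<close>
lemma conditional_cdf_sandwich:
  fixes U V :: "'w \<Rightarrow> 'h::topological_space" and F :: "'h \<Rightarrow> real"
  assumes "prob_space M" "subalgebra M G"
    and U: "regular_cond_dist M G U \<kappa>" and V [measurable]: "V \<in> borel_measurable M"
    and "prob_space \<mu>" and [measurable_cong]: "sets \<mu> = sets borel"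
    and V_law: "\<And>A. A \<in> sets borel \<Longrightarrow> AE w in M. cond_probability M G (V -` A \<inter> space M) w = measure \<mu> A"
    and F [measurable]: "F \<in> borel_measurable borel"
    and E [measurable]: "E \<in> sets M" and close: "\<And>w. w \<in> E \<Longrightarrow> \<bar>F (U w) - F (V w)\<bar> \<le> r"
    and wp: "with_prob M G p (\<lambda>w. 1 - \<eta> \<le> cond_probability M G E w)"
  shows "with_prob M G p (\<lambda>w. w \<in> space M \<and> (\<forall>t.
      measure (\<kappa> w) {x. F x \<le> t} \<le> measure \<mu> {x. F x \<le> t + r} + \<eta> \<and>
      measure \<mu> {x. F x \<le> t - r} \<le> measure (\<kappa> w) {x. F x \<le> t} + \<eta>))"
proof -
  interpret prob_space M by fact
  interpret finite_measure_subalgebra M G by standard fact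
  have U_meas [measurable]: "U \<in> borel_measurable M" and \<kappa> [measurable]: "\<kappa> \<in> measurable G (prob_algebra borel)"
    and U_law: "\<And>A. A \<in> sets borel \<Longrightarrow> AE w in M. cond_probability M G (U -` A \<inter> space M) w = measure (\<kappa> w) A"
    using U by (auto simp: regular_cond_dist_def)
  have \<kappa>_meas [measurable]: "(\<lambda>w. measure (\<kappa> w) A) \<in> borel_measurable G" if "A \<in> sets borel" for A
    using measurable_prob_algebraD[OF \<kappa>] measurable_measure_subprob_algebra[OF that]
    by (rule measurable_compose)
  have [measurable]: "cond_probability M G E \<in> borel_measurable G"
    unfolding cond_probability_def by (rule borel_measurable_cond_exp)
  have spG: "space G = space M" using subalg by (simp add: subalgebra_def)
  let ?S = "\<lambda>w q. measure (\<kappa> w) {x. F x \<le> q} \<le> measure \<mu> {x. F x \<le> q + r} + (1 - cond_probability M G E w)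
      \<and> measure \<mu> {x. F x \<le> q - r} \<le> measure (\<kappa> w) {x. F x \<le> q} + (1 - cond_probability M G E w)"
  have S_AE: "AE w in M. ?S w q" for q
  proof -
    let ?u = "\<lambda>q. U -` {x. F x \<le> q} \<inter> space M" and ?v = "\<lambda>q. V -` {x. F x \<le> q} \<inter> space M"
    have [measurable]: "?u q \<in> sets M" "?v q \<in> sets M" for q by measurable
    have "AE w in M. cond_probability M G (?u q) w
        \<le> cond_probability M G (?v (q + r)) w + (1 - cond_probability M G E w)"
      using close by (intro cond_probability_le_except[OF assms(1,2)]) (auto simp: abs_le_iff, fastforce)
    moreover have "AE w in M. cond_probability M G (?v (q - r)) w
        \<le> cond_probability M G (?u q) w + (1 - cond_probability M G E w)"
      using close by (intro cond_probability_le_except[OF assms(1,2)]) (auto simp: abs_le_iff, fastforce)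
    moreover have "AE w in M. cond_probability M G (?v s) w = measure \<mu> {x. F x \<le> s}" for s
      by (rule V_law) simp
    note this[of "q + r"] this[of "q - r"]
    moreover have "AE w in M. cond_probability M G (?u q) w = measure (\<kappa> w) {x. F x \<le> q}"
      by (rule U_law) simp
    ultimately show ?thesis by eventually_elim auto
  qed
  then have "AE w in M. \<forall>q. ?S w (of_rat q)"
    by (simp add: AE_all_countable)
  moreover have "{w \<in> space M. \<forall>q. ?S w (of_rat q)} \<in> sets G"
    unfolding spG[symmetric] by measurable
  ultimately have "with_prob M G p (\<lambda>w. 1 - \<eta> \<le> cond_probability M G E w
      \<and> (\<forall>q. ?S w (of_rat q)) \<and> w \<in> space M)"
    by (intro with_prob_conj_AE[OF assms(1,2) wp])
  then show ?thesis
  proof (rule with_prob_mono, intro conjI allI)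
    fix w t assume w: "1 - \<eta> \<le> cond_probability M G E w \<and> (\<forall>q. ?S w (of_rat q)) \<and> w \<in> space M"
    then show "w \<in> space M" by simp
    have "\<kappa> w \<in> space (prob_algebra borel)"
      using w spG by (intro measurable_space[OF \<kappa>]) simp
    then have \<kappa>w: "prob_space (\<kappa> w)" and [measurable_cong]: "sets (\<kappa> w) = sets borel"
      by (auto simp: space_prob_algebra)
    have [simp]: "space (\<kappa> w) = UNIV" "space \<mu> = UNIV"
      using \<open>sets (\<kappa> w) = _\<close> \<open>sets \<mu> = _\<close> by (auto dest: sets_eq_imp_space_eq)
    interpret \<mu>: prob_space \<mu> by fact
    interpret \<kappa>: prob_space "\<kappa> w" by fact
    show "measure (\<kappa> w) {x. F x \<le> t} \<le> measure \<mu> {x. F x \<le> t + r} + \<eta>"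
    proof -
      have "measure (\<kappa> w) {x. F x \<le> t} \<le> \<P>(x in \<mu>. F x \<le> of_rat q + r) + \<eta>" if "t < of_rat q" for q
      proof -
        have "measure (\<kappa> w) {x. F x \<le> t} \<le> measure (\<kappa> w) {x. F x \<le> of_rat q}"
          using that by (intro \<kappa>.finite_measure_mono) auto
        moreover have "?S w (of_rat q)" "1 - \<eta> \<le> cond_probability M G E w" using w by auto
        ultimately show ?thesis by simp
      qed
      then show ?thesis
        using cdf_limit_from_right[OF \<open>prob_space \<mu>\<close>, of F t "measure (\<kappa> w) {x. F x \<le> t}" r \<eta>] by simp
    qed
    show "measure \<mu> {x. F x \<le> t - r} \<le> measure (\<kappa> w) {x. F x \<le> t} + \<eta>"
    proof -
      have "measure \<mu> {x. F x \<le> t - r} \<le> \<P>(x in \<kappa> w. F x \<le> of_rat q + 0) + \<eta>" if "t < of_rat q" for q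
      proof -
        have "measure \<mu> {x. F x \<le> t - r} \<le> measure \<mu> {x. F x \<le> of_rat q - r}"
          using that by (intro \<mu>.finite_measure_mono) auto
        moreover have "?S w (of_rat q)" "1 - \<eta> \<le> cond_probability M G E w" using w by auto
        ultimately show ?thesis by simp
      qed
      then show ?thesis
        using cdf_limit_from_right[OF \<kappa>w, of F t "measure \<mu> {x. F x \<le> t - r}" 0 \<eta>] by simp
    qed
  qed
qed

section \<open>Accuracy of the bootstrap\<close>

theorem proposition2:
  fixes k :: "'s::polish_space \<Rightarrow> 's \<Rightarrow> real" and \<kappa> :: real
    and K :: "'s \<Rightarrow> 'h::{real_inner,banach,polish_space}"
    and M :: "'w measure" and P :: "('s \<times> real) measure"
    and n :: nat and lam \<eta> :: real
    and X :: "nat \<Rightarrow> 'w \<Rightarrow> 's" and Y :: "nat \<Rightarrow> 'w \<Rightarrow> real"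
    and f0 :: 'h and \<sigma>_up \<sigma>_lo :: real
    and h :: "nat \<Rightarrow> nat \<Rightarrow> 'w \<Rightarrow> real"
    and F :: "'h \<Rightarrow> real" and \<psi> :: "real \<Rightarrow> real"
    and Z Z' :: "'w \<Rightarrow> 'h"
    and Q R B :: real and L :: "real \<Rightarrow> real \<Rightarrow> real"
    and \<B>_law :: "'w \<Rightarrow> 'h measure"
  defines "\<G> \<equiv> data_algebra M n X Y"
    and "f_hat \<equiv> (\<lambda>w. ridge K n lam (data n X Y w))"
    and "f_lam \<equiv> pop_ridge K P lam"
    and "\<Sigma> \<equiv> influence_cov K P lam f0"
    and "\<B> \<equiv> (\<lambda>w. bootstrap K n lam (data n X Y w) (\<lambda>i j. h i j w))"
  assumes kernel: "pos_def_kernel k" "\<And>x x'. k x x' \<le> \<kappa>\<^sup>2"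
    and rkhs: "is_rkhs k K" "K \<in> borel_measurable borel"
    and prob: "prob_space M"
    and params: "n \<ge> 1" "lam > 0" "0 < \<eta>" "\<eta> < 1"
    and iid: "prob_space.indep_vars M (\<lambda>_. borel) (\<lambda>i w. (X i w, Y i w)) {1..n}"
      "\<And>i. i \<in> {1..n} \<Longrightarrow> distr M borel (\<lambda>w. (X i w, Y i w)) = P"
    and regression: "AE z in P. real_cond_exp P (vimage_algebra (space P) fst borel) snd z = rkhs_eval K f0 (fst z)"
    and noise_up: "AE z in P. \<bar>snd z - rkhs_eval K f0 (fst z)\<bar> \<le> \<sigma>_up"
    and noise_lo: "\<sigma>_lo\<^sup>2 > 0"
      "AE z in P. real_cond_exp P (vimage_algebra (space P) fst borel)
                    (\<lambda>z. (snd z - rkhs_eval K f0 (fst z))\<^sup>2) z \<ge> \<sigma>_lo\<^sup>2"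
    and multipliers:
      "prob_space.indep_vars M (\<lambda>_. borel) (\<lambda>(i, j). h i j) ({1..n} \<times> {1..n})"
      "\<And>i j. i \<in> {1..n} \<Longrightarrow> j \<in> {1..n} \<Longrightarrow> distributed M lborel (h i j) std_normal_density"
      "prob_space.indep_set M (sets \<G>)
         (sets (vimage_algebra (space M) (\<lambda>w. restrict (\<lambda>(i, j). h i j w) ({1..n} \<times> {1..n}))
                  (\<Pi>\<^sub>M p\<in>{1..n} \<times> {1..n}. borel)))"
    and F: "modulus_of_continuity \<psi>" "\<And>u v. \<bar>F u - F v\<bar> \<le> \<psi> (norm (u - v))"
    and i: "Z \<in> borel_measurable M"
      "centered_gaussian (distr M borel Z)" "has_covariance (distr M borel Z) \<Sigma>"
      "with_prob M M (1 - \<eta>) (\<lambda>w. norm (sqrt (real n) *\<^sub>R (f_hat w - f_lam) - Z w) \<le> Q)"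
    and ii: "\<exists>\<nu>. regular_cond_dist M \<G> Z' \<nu> \<and>
               (AE w in M. centered_gaussian (\<nu> w) \<and> has_covariance (\<nu> w) \<Sigma>)"
      "with_prob M \<G> (1 - \<eta>)
         (\<lambda>w. cond_probability M \<G> {w' \<in> space M. norm (\<B> w' - Z' w') \<le> R} w \<ge> 1 - \<eta>)"
    and iii: "strict_mono_on {0<..<1} (L lam)"
      "\<And>\<eta>'. 0 < \<eta>' \<Longrightarrow> \<eta>' < 1 \<Longrightarrow> with_prob M M (1 - \<eta>') (\<lambda>w. norm (Z w) \<ge> L lam \<eta>')"
    and iv: "sqrt (real n) * norm (f_lam - f0) \<le> B"
    and cond_law: "regular_cond_dist M \<G> \<B> \<B>_law"
  shows "(\<forall>\<aa> :: real \<Rightarrow> real.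
            mono_on {0<..} \<aa> \<longrightarrow> (\<forall>r>0. \<aa> r \<in> {0..1}) \<longrightarrow> (\<aa> \<longlongrightarrow> 0) (at_right 0) \<longrightarrow> \<aa> 0 = 0 \<longrightarrow>
            (\<forall>r>0. (SUP t. \<P>(w in M. \<bar>F (Z w) - t\<bar> \<le> r)) \<le> \<aa> r) \<longrightarrow>
            with_prob M \<G> (1 - \<eta>) (\<lambda>w.
              (SUP t. \<bar>\<P>(w' in M. F (sqrt (real n) *\<^sub>R (f_hat w' - f0)) \<le> t)
                        - measure (\<B>_law w) {b. F b \<le> t}\<bar>)
              \<le> \<aa> (\<psi> (Q + B)) + \<aa> (\<psi> R) + 2 * \<eta>))
       \<and> with_prob M \<G> (1 - \<eta>) (\<lambda>w.
            (SUP t. \<bar>\<P>(w' in M. F (sqrt (real n) *\<^sub>R (f_hat w' - f0)) \<le> t)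
                      - measure (\<B>_law w) {b. F b \<le> t}\<bar>)
            \<le> 2 * (SUP t. measure (\<B>_law w) {b. \<bar>F b - t\<bar> \<le> 2 * \<psi> ((Q + R) + B)}) + 4 * \<eta>)"
proof -
  interpret prob_space M by (rule prob)
  define U where "U w = sqrt (real n) *\<^sub>R (f_hat w - f0)" for w
  define \<mu> where "\<mu> = distr M borel Z"
  define r1 r2 where "r1 = \<psi> (Q + B)" and "r2 = \<psi> R"

  have F_meas [measurable]: "F \<in> borel_measurable borel"
    by (intro borel_measurable_continuous_onI continuous_on_if_modulus[OF F])
  have Z_meas [measurable]: "Z \<in> borel_measurable M" by (rule i(1))
  have \<B>_meas [measurable]: "\<B> \<in> borel_measurable M"
    using cond_law by (simp add: regular_cond_dist_def)
  have Z'_meas [measurable]: "Z' \<in> borel_measurable M"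
    using ii(1) by (auto simp: regular_cond_dist_def)
  have XY: "(\<lambda>w. (X j w, Y j w)) \<in> borel_measurable M" if "j \<in> {1..n}" for j
    using iid(1) that by (simp add: indep_vars_def)
  have "(\<lambda>w. fst (data n X Y w j)) \<in> borel_measurable M"
       "(\<lambda>w. snd (data n X Y w j)) \<in> borel_measurable M" if "j \<in> {1..n}" for j
    using that
      measurable_compose[OF XY[OF that] borel_measurable_continuous_onI[OF continuous_on_fst[OF continuous_on_id]]]
      measurable_compose[OF XY[OF that] borel_measurable_continuous_onI[OF continuous_on_snd[OF continuous_on_id]]]
    by (simp_all add: data_def)
  then have f_hat_meas [measurable]: "f_hat \<in> borel_measurable M"
    unfolding f_hat_def by (intro borel_measurable_ridge rkhs(2) params(2))
  have U_meas [measurable]: "U \<in> borel_measurable M"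
    unfolding U_def by measurable
  have "data n X Y \<in> measurable M (\<Pi>\<^sub>M i\<in>{1..n}. borel)"
    unfolding data_def by (intro measurable_restrict XY)
  then have subalg: "subalgebra M \<G>"
    unfolding subalgebra_def \<G>_def data_algebra_def by (auto dest: sets_image_in_sets[OF refl])

  interpret \<mu>: prob_space \<mu>
    unfolding \<mu>_def by (rule prob_space_distr) simp
  have \<mu>_sets: "sets \<mu> = sets borel" by (simp add: \<mu>_def)
  have \<mu>_cdf: "measure \<mu> {x. F x \<le> t} = \<P>(w in M. F (Z w) \<le> t)" for t
    unfolding \<mu>_def by (subst measure_distr) (auto intro!: arg_cong[where f=prob])

  have \<psi>_mono: "\<psi> x \<le> \<psi> y" if "0 \<le> x" "x \<le> y" for x y
    using F(1) that by (auto simp: modulus_of_continuity_def mono_on_def)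
  have \<psi>_nonneg: "0 \<le> \<psi> x" if "0 \<le> x" for x
    using F(1) \<psi>_mono[of 0 x] that by (simp add: modulus_of_continuity_def)

  obtain E where E: "E \<in> events" "1 - \<eta> \<le> prob E"
      "\<And>w. w \<in> E \<Longrightarrow> norm (sqrt (real n) *\<^sub>R (f_hat w - f_lam) - Z w) \<le> Q"
    using i(4) unfolding with_prob_def by blast
  \<comment> \<open>\<open>\<psi>\<close> is only monotone on \<open>{0..}\<close>, so the signs of \<open>Q\<close>, \<open>B\<close> and \<open>R\<close> matter. Each bounds a norm at some point,
    because the events in question have positive probability.\<close>
  have "0 \<le> Q"
    using with_prob_ex[OF i(4)] params(4) by (auto intro: order_trans[OF norm_ge_zero])
  have "0 \<le> B"
    using iv by (rule order_trans[rotated]) simp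
  have close1: "\<bar>F (U w) - F (Z w)\<bar> \<le> r1" if "w \<in> E" for w
  proof -
    have "U w - Z w = (sqrt (real n) *\<^sub>R (f_hat w - f_lam) - Z w) + sqrt (real n) *\<^sub>R (f_lam - f0)"
      by (simp add: U_def algebra_simps)
    then have "norm (U w - Z w) \<le> norm (sqrt (real n) *\<^sub>R (f_hat w - f_lam) - Z w) + norm (sqrt (real n) *\<^sub>R (f_lam - f0))"
      by (simp only: norm_triangle_ineq)
    also have "\<dots> \<le> Q + B"
      using E(3)[OF that] iv by simp
    finally have "\<psi> (norm (U w - Z w)) \<le> r1"
      unfolding r1_def by (intro \<psi>_mono) simp_all
    then show ?thesis using F(2)[of "U w" "Z w"] by linarith
  qed
  have U_le_Z: "\<P>(w in M. F (U w) \<le> t) \<le> \<P>(w in M. F (Z w) \<le> t + r1) + \<eta>" for t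
    using E(1,2) close1 by (intro prob_le_except[of _ _ E]) (auto simp: abs_le_iff, fastforce)
  have Z_le_U: "\<P>(w in M. F (Z w) \<le> t - r1) \<le> \<P>(w in M. F (U w) \<le> t) + \<eta>" for t
    using E(1,2) close1 by (intro prob_le_except[of _ _ E]) (auto simp: abs_le_iff, fastforce)

  obtain \<nu> where \<nu>: "regular_cond_dist M \<G> Z' \<nu>"
      "AE w in M. centered_gaussian (\<nu> w) \<and> has_covariance (\<nu> w) \<Sigma>"
    using ii(1) by blast
  have Z'_law: "AE w in M. cond_probability M \<G> (Z' -` A \<inter> space M) w = measure \<mu> A"
    if "A \<in> sets borel" for A
  proof -
    have "AE w in M. cond_probability M \<G> (Z' -` A \<inter> space M) w = measure (\<nu> w) A"
      using \<nu>(1) that by (simp add: regular_cond_dist_def)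
    then show ?thesis
      using \<nu>(2)
    proof eventually_elim
      case (elim w)
      then have "\<nu> w = \<mu>"
        using i(2,3) unfolding \<mu>_def by (intro centered_gaussian_eq_if_covariance_eq) auto
      with elim show ?case by simp
    qed
  qed
  let ?G = "{w' \<in> space M. norm (\<B> w' - Z' w') \<le> R}"
  have "?G \<noteq> {}"
    by (rule cond_probability_event_nonempty[OF prob subalg _ _ ii(2)]) (use params(4) in simp_all)
  then have "0 \<le> R"
    by (auto intro: order_trans[OF norm_ge_zero])
  have close2: "\<bar>F (\<B> w) - F (Z' w)\<bar> \<le> r2" if "w \<in> ?G" for w
  proof -
    have "\<psi> (norm (\<B> w - Z' w)) \<le> r2"
      unfolding r2_def using that by (intro \<psi>_mono) simp_all
    then show ?thesis using F(2)[of "\<B> w" "Z' w"] by linarith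
  qed
  have boot: "with_prob M \<G> (1 - \<eta>) (\<lambda>w. w \<in> space M \<and> (\<forall>t.
      measure (\<B>_law w) {b. F b \<le> t} \<le> \<P>(w in M. F (Z w) \<le> t + r2) + \<eta> \<and>
      \<P>(w in M. F (Z w) \<le> t - r2) \<le> measure (\<B>_law w) {b. F b \<le> t} + \<eta>))"
    using conditional_cdf_sandwich[OF prob subalg cond_law Z'_meas \<mu>.prob_space_axioms \<mu>_sets
        Z'_law F_meas _ close2 ii(2)]
    by (simp add: \<mu>_cdf)

  have r: "0 \<le> r1" "0 \<le> r2" "r1 + r2 \<le> 2 * \<psi> ((Q + R) + B)"
  proof -
    show "0 \<le> r1" "0 \<le> r2"
      unfolding r1_def r2_def using \<open>0 \<le> Q\<close> \<open>0 \<le> B\<close> \<open>0 \<le> R\<close> by (auto intro: \<psi>_nonneg)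
    have "r1 \<le> \<psi> ((Q + R) + B)" "r2 \<le> \<psi> ((Q + R) + B)"
      unfolding r1_def r2_def using \<open>0 \<le> Q\<close> \<open>0 \<le> B\<close> \<open>0 \<le> R\<close> by (auto intro: \<psi>_mono)
    then show "r1 + r2 \<le> 2 * \<psi> ((Q + R) + B)" by linarith
  qed

  let ?p = "\<lambda>t. \<P>(w' in M. F (sqrt (real n) *\<^sub>R (f_hat w' - f0)) \<le> t)"
  let ?m = "\<lambda>t. \<P>(w in M. F (Z w) \<le> t)"
  let ?b = "\<lambda>w t. measure (\<B>_law w) {b. F b \<le> t}"
  have p: "?p t \<le> ?m (t + r1) + \<eta>" "?m (t - r1) \<le> ?p t + \<eta>" for t
    using U_le_Z[of t] Z_le_U[of t] by (simp_all add: U_def)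

  show ?thesis
  proof (intro conjI allI impI)
    fix \<aa> :: "real \<Rightarrow> real"
    assume "\<aa> 0 = 0" and anti: "\<forall>r>0. (SUP t. \<P>(w in M. \<bar>F (Z w) - t\<bar> \<le> r)) \<le> \<aa> r"
    have incr: "?m (t + r) \<le> ?m t + \<aa> r" if "0 \<le> r" for t r
    \<comment> \<open>\<open>\<psi>\<close> may vanish at positive arguments, so a shift can be \<open>0\<close>. Anti-concentration bounds
      increments over positive lengths only; for \<open>r = 0\<close> both sides agree because \<open>\<aa> 0 = 0\<close>.\<close>
    proof (cases "r = 0")
      case False
      then have "(SUP t. \<P>(w in M. \<bar>F (Z w) - t\<bar> \<le> r)) \<le> \<aa> r" using anti that by simp
      then show ?thesis
        using prob_increment_le[of "\<lambda>w. F (Z w)" r t] that by simp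
    qed (simp add: \<open>\<aa> 0 = 0\<close>)
    show "with_prob M \<G> (1 - \<eta>) (\<lambda>w. (SUP t. \<bar>?p t - ?b w t\<bar>) \<le> \<aa> (\<psi> (Q + B)) + \<aa> (\<psi> R) + 2 * \<eta>)"
    proof (rule with_prob_mono[OF boot], rule cSUP_least)
      fix w t
      assume w: "w \<in> space M \<and> (\<forall>t. ?b w t \<le> ?m (t + r2) + \<eta> \<and> ?m (t - r2) \<le> ?b w t + \<eta>)"
      have "?m t \<le> ?m (t - r1) + \<aa> r1" "?m t \<le> ?m (t - r2) + \<aa> r2"
        using incr[OF r(1), of "t - r1"] incr[OF r(2), of "t - r2"] by simp_all
      moreover have "?b w t \<le> ?m (t + r2) + \<eta>" "?m (t - r2) \<le> ?b w t + \<eta>"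
        using w by auto
      ultimately show "\<bar>?p t - ?b w t\<bar> \<le> \<aa> (\<psi> (Q + B)) + \<aa> (\<psi> R) + 2 * \<eta>"
        using p[of t] incr[OF r(1), of t] incr[OF r(2), of t] unfolding r1_def[symmetric] r2_def[symmetric]
        by linarith
    qed simp
  next
    define \<rho> where "\<rho> = 2 * \<psi> ((Q + R) + B)"
    show "with_prob M \<G> (1 - \<eta>) (\<lambda>w. (SUP t. \<bar>?p t - ?b w t\<bar>)
        \<le> 2 * (SUP t. measure (\<B>_law w) {b. \<bar>F b - t\<bar> \<le> 2 * \<psi> ((Q + R) + B)}) + 4 * \<eta>)"
      unfolding \<rho>_def[symmetric]
    proof (rule with_prob_mono[OF boot], rule cSUP_least)
      fix w t
      assume w: "w \<in> space M \<and> (\<forall>t. ?b w t \<le> ?m (t + r2) + \<eta> \<and> ?m (t - r2) \<le> ?b w t + \<eta>)"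
      let ?S = "SUP t. measure (\<B>_law w) {b. \<bar>F b - t\<bar> \<le> \<rho>}"
      have "\<B>_law \<in> measurable \<G> (prob_algebra borel)" "w \<in> space \<G>"
        using cond_law w subalg by (auto simp: regular_cond_dist_def subalgebra_def)
      then have "\<B>_law w \<in> space (prob_algebra borel)"
        by (rule measurable_space)
      then have law: "prob_space (\<B>_law w)" and [measurable_cong]: "sets (\<B>_law w) = sets borel"
        by (auto simp: space_prob_algebra)
      interpret b: prob_space "\<B>_law w" by (rule law)
      have [simp]: "space (\<B>_law w) = UNIV"
        using \<open>sets (\<B>_law w) = _\<close> by (auto dest: sets_eq_imp_space_eq)
      have incr: "?b w (s + \<rho>) \<le> ?b w s + ?S" for s
        using b.prob_increment_le[of F \<rho> s] r unfolding \<rho>_def by simp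
      have mono: "?b w s \<le> ?b w s'" if "s \<le> s'" for s s'
        using that by (intro b.finite_measure_mono) auto
      have "0 \<le> measure (\<B>_law w) {b. \<bar>F b - 0\<bar> \<le> \<rho>}" by simp
      also have "\<dots> \<le> ?S" by (intro cSUP_upper bdd_aboveI2[where M=1]) auto
      finally have "0 \<le> ?S" .
      have "?m (t + r1) \<le> ?b w (t + r1 + r2) + \<eta>" "?b w (t - r1 - r2) \<le> ?m (t - r1) + \<eta>"
        using w[THEN conjunct2, THEN spec, of "t + r1 + r2"] w[THEN conjunct2, THEN spec, of "t - r1 - r2"]
        by simp_all
      moreover have "?b w (t + r1 + r2) \<le> ?b w (t + \<rho>)" "?b w (t - \<rho>) \<le> ?b w (t - r1 - r2)"
        using r(3) unfolding \<rho>_def by (auto intro!: mono)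
      ultimately show "\<bar>?p t - ?b w t\<bar> \<le> 2 * ?S + 4 * \<eta>"
        using p[of t] incr[of t] incr[of "t - \<rho>"] \<open>0 \<le> ?S\<close> params(3) by simp
    qed simp
  qed
qed

end
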